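(* Let $\mathcal{T}=(t_{ijkl})$ be a real 4th-order 3-dimensional symmetric tensor. Assume $t_{1222}=t_{2333}=t_{1113}$, $t_{1112}=t_{1333}=t_{2223}$, and $|t_{iiij}|=t_{iiii}=t_{iijj}=1$ and $t_{ijjj}t_{iiij}=-1$ for all $i,j\in\{1,2,3\}$ with $i\ne j$. Then: (i) $\mathcal{T}$ is positive definite if $t_{1123},t_{1223},t_{1233}\in\left(-\frac{7}{12},-\frac14\right]$; (ii) $\mathcal{T}$ is positive definite if $t_{1123},t_{1223},t_{1233}\in\left[-\frac14,-\frac16\right]$.
   Context: A 4th-order 3-dimensional real tensor $\mathcal{T}=(t_{ijkl})_{1\le i,j,k,l\le 3}$ is symmetric if its entries are invariant under all permutations of the indices. For $x\in\mathbb{R}^3$, $\mathcal{T}x^4=\sum_{i,j,k,l=1}^3 t_{ijkl}x_ix_jx_kx_l$. $\mathcal{T}$ is positive definite if $\mathcal{T}x^4> 0$ for all $x\in\mathbb{R}^3\setminus\{0\}$. *)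

theory Defs
  imports "HOL-Analysis.Analysis" "HOL-Combinatorics.Permutations"
begin

text \<open>
  A fourth-order tensor on \<open>real ^ 'n\<close> is the nested vector of its entries; the entry
  $t_{ijkl}$ is \<open>T $ i $ j $ k $ l\<close>.  For \<open>'n = 3\<close> the type of indices has exactly the
  elements 1, 2, 3 (the numeral 3 being equal to 0 there).
\<close>

type_synonym 'n tensor4 = "real ^ 'n ^ 'n ^ 'n ^ 'n"

text \<open>
  A multi-index is the restriction of \<open>m\<close> to the four positions 1, ..., 4, and the permutations
  act on the positions.
\<close>

definition symmetric_tensor4 :: "'n::finite tensor4 \<Rightarrow> bool" where
  "symmetric_tensor4 T \<longleftrightarrow>
     (\<forall>p (m :: nat \<Rightarrow> 'n). p permutes {1..4} \<longrightarrow>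
        T $ m (p 1) $ m (p 2) $ m (p 3) $ m (p 4) = T $ m 1 $ m 2 $ m 3 $ m 4)"

definition tensor4_form :: "'n::finite tensor4 \<Rightarrow> real ^ 'n \<Rightarrow> real" where
  "tensor4_form T x =
     (\<Sum>i\<in>UNIV. \<Sum>j\<in>UNIV. \<Sum>k\<in>UNIV. \<Sum>l\<in>UNIV.
        T $ i $ j $ k $ l * x $ i * x $ j * x $ k * x $ l)"

definition positive_definite_tensor4 :: "'n::finite tensor4 \<Rightarrow> bool" where
  "positive_definite_tensor4 T \<longleftrightarrow> (\<forall>x. x \<noteq> 0 \<longrightarrow> tensor4_form T x > 0)"

end

theory Submission
  imports Defs
begin

text \<open>
  Put \<open>a, b, c\<close> for the three entries $t_{1123}, t_{1223}, t_{1233}$ and \<open>e\<close> for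
  $t_{1222}$, which is 1 or -1.  The hypotheses determine all other entries, so that the form is a
  ternary quartic which is affine in \<open>(a, b, c)\<close>; the term that contains them is
  \<open>12xyz (ax + by + cz)\<close>.  Interchanging \<open>x\<close> with \<open>y\<close> and \<open>a\<close> with \<open>b\<close> reverses the sign of \<open>e\<close>,
  so let \<open>e = 1\<close>; the form is then invariant under simultaneous cyclic shifts of \<open>(x, y, z)\<close> and
  \<open>(a, b, c)\<close>.

  On the planes \<open>xyz = 0\<close> the form is a binary quartic, which is an explicit sum of squares.  Off
  these planes, the coefficients \<open>12x\<^sup>2yz, 12xy\<^sup>2z, 12xyz\<^sup>2\<close> of \<open>a, b, c\<close> have a positive product.
  Hence all three are positive, or exactly one of them is, and cyclic symmetry lets it be that of \<open>a\<close>.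
  Since the form is increasing in a parameter with positive coefficient and decreasing in one with
  negative coefficient, it is enough to know it at one corner of the parameter box in each case:

    \<^item> if all coefficients are positive, at \<open>(-7/12, -7/12, -7/12)\<close>, where it is nonnegative and
      vanishes at \<open>(1, 1, 1)\<close>, which is why \<open>-7/12\<close> is an excluded bound;
    \<^item> if only that of \<open>a\<close> is positive, at \<open>(-7/12, -1/4, -1/4)\<close> for the box of the first part
      and at \<open>(-1/4, -1/6, -1/6)\<close> for the box of the second.

  The two boxes cannot be treated as one: \<open>(-7/12, -1/6, -1/6)\<close> is a corner of the smallest box
  that contains both, and with these parameters the form takes negative values.  At each of the
  three corners the required bound follows from a decomposition into squares.
\<close>

section \<open>The ternary quartic of the tensor\<close>

definition tensor_quartic :: "real \<Rightarrow> real \<Rightarrow> real \<Rightarrow> real \<Rightarrow> real \<Rightarrow> real \<Rightarrow> real \<Rightarrow> real" where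
  "tensor_quartic e a b c x y z =
     x^4 + y^4 + z^4 + 6 * (x^2 * y^2 + y^2 * z^2 + z^2 * x^2)
     + 4 * e * (x * y^3 - x^3 * y + y * z^3 - y^3 * z + z * x^3 - z^3 * x)
     + 12 * (x * y * z) * (a * x + b * y + c * z)"

text \<open>The transpositions of neighbouring positions generate all permutations of the positions, so
  that these three equations, used as permutative rewrite rules, bring the indices of every entry
  into one fixed order.\<close>

lemma symmetric_tensor4_swap:
  assumes "symmetric_tensor4 T"
  shows "T $ j $ i $ k $ l = T $ i $ j $ k $ l"
    and "T $ i $ k $ j $ l = T $ i $ j $ k $ l"
    and "T $ i $ j $ l $ k = T $ i $ j $ k $ l"
proof -
  define m :: "nat \<Rightarrow> _" where "m n = (if n = 1 then i else if n = 2 then j else if n = 3 then k else l)" for n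
  have inv: "T $ m (p 1) $ m (p 2) $ m (p 3) $ m (p 4) = T $ m 1 $ m 2 $ m 3 $ m 4"
    if "p permutes {1..4}" for p
    using assms that unfolding symmetric_tensor4_def by blast
  have "Transposition.transpose 1 2 permutes {1..4::nat}" "Transposition.transpose 2 3 permutes {1..4::nat}"
    "Transposition.transpose 3 4 permutes {1..4::nat}"
    by (auto intro!: permutes_swap_id)
  from this[THEN inv] show "T $ j $ i $ k $ l = T $ i $ j $ k $ l"
    and "T $ i $ k $ j $ l = T $ i $ j $ k $ l"
    and "T $ i $ j $ l $ k = T $ i $ j $ k $ l"
    by (simp_all add: m_def Transposition.transpose_def)
qed

lemma tensor4_form_eq_tensor_quartic:
  fixes T :: "3 tensor4"
  assumes "symmetric_tensor4 T"
    and diag: "T $ 1 $ 1 $ 1 $ 1 = 1" "T $ 2 $ 2 $ 2 $ 2 = 1" "T $ 3 $ 3 $ 3 $ 3 = 1"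
    and pairs: "T $ 1 $ 1 $ 2 $ 2 = 1" "T $ 2 $ 2 $ 3 $ 3 = 1" "T $ 1 $ 1 $ 3 $ 3 = 1"
    and plus: "T $ 1 $ 2 $ 2 $ 2 = e" "T $ 2 $ 3 $ 3 $ 3 = e" "T $ 1 $ 1 $ 1 $ 3 = e"
    and minus: "T $ 1 $ 1 $ 1 $ 2 = - e" "T $ 1 $ 3 $ 3 $ 3 = - e" "T $ 2 $ 2 $ 2 $ 3 = - e"
  shows "tensor4_form T x =
    tensor_quartic e (T $ 1 $ 1 $ 2 $ 3) (T $ 1 $ 2 $ 2 $ 3) (T $ 1 $ 2 $ 3 $ 3) (x $ 1) (x $ 2) (x $ 3)"
proof -
  note swap = symmetric_tensor4_swap[OF assms(1)]
  \<comment> \<open>The order that the simplifier picks need not be the increasing one, so the known entries have to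
    be normalised as well.\<close>
  note entries = diag[simplified swap] pairs[simplified swap] plus[simplified swap] minus[simplified swap]
  show ?thesis
    unfolding tensor4_form_def tensor_quartic_def sum_3
    by (simp add: swap entries) (simp add: algebra_simps power2_eq_square power3_eq_cube power4_eq_xxxx)
qed

lemma tensor_quartic_swap:
  "tensor_quartic (- e) a b c x y z = tensor_quartic e b a c y x z"
  unfolding tensor_quartic_def by algebra

lemma tensor_quartic_cycle:
  "tensor_quartic e a b c x y z = tensor_quartic e b c a y z x"
  unfolding tensor_quartic_def by algebra

section \<open>Sums of squares\<close>

text \<open>With equal parameters the quartic is cyclic, and so is the certificate.  Every square in it has
  to vanish at the zero \<open>(1, 1, 1)\<close>.  Take one sixth of the sum of the cyclic shifts of
  \<open>(2x\<^sup>2 - y\<^sup>2 - z\<^sup>2 + s xy + t yz + u zx)\<^sup>2\<close> with \<open>s + t + u = 0\<close>: the coefficients of \<open>x\<^sup>3y\<close> and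
  \<open>xy\<^sup>3\<close> are then \<open>s\<close> and \<open>u\<close>, which forces \<open>s = -4\<close>, \<open>u = 4\<close>, \<open>t = 0\<close>, and what is left over is
  a multiple of the sum of the cyclic shifts of \<open>(xy - yz)\<^sup>2\<close>.\<close>

lemma tensor_quartic_lower_corner_nonneg:
  "tensor_quartic 1 (-7/12) (-7/12) (-7/12) x y z \<ge> 0"
proof -
  have "tensor_quartic 1 (-7/12) (-7/12) (-7/12) x y z =
      1/6 * ((2*x^2 - y^2 - z^2 - 4*x*y + 4*z*x)^2
           + (2*y^2 - z^2 - x^2 - 4*y*z + 4*x*y)^2
           + (2*z^2 - x^2 - y^2 - 4*z*x + 4*y*z)^2)
      + 5/6 * ((x*y - y*z)^2 + (y*z - z*x)^2 + (z*x - x*y)^2)"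
    unfolding tensor_quartic_def by (simp add: field_simps) algebra
  then show ?thesis by simp
qed

text \<open>The next two certificates are triangular: the quartic is written as a quadratic form in the six
  monomials of degree two, whose matrix has six free parameters because \<open>x\<^sup>2 \<cdot> y\<^sup>2 = (xy)\<^sup>2\<close>,
  \<open>x\<^sup>2 \<cdot> yz = xy \<cdot> xz\<close> and so on.  The parameters are small fractions near the maximiser of
  the determinant among the positive definite ones of these matrices, and the squares are completed
  one monomial at a time.  The last square is a single monomial, which makes the sum positive off the
  coordinate planes.\<close>

lemma tensor_quartic_corner_pos:
  assumes "x * y * z \<noteq> 0"
  shows "tensor_quartic 1 (-7/12) (-1/4) (-1/4) x y z > 0"
proof -
  have "tensor_quartic 1 (-7/12) (-1/4) (-1/4) x y z =
      (x^2 - 1/2*y^2 + 2*x*z - 1/2*z^2 - 2*x*y)^2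
      + 3/4 * (y^2 + x*z - 8/3*y*z - 5/6*z^2 + 4/3*x*y)^2
      + 9/4 * (x*z - 1/6*z^2 - 2/9*x*y)^2
      + 17/12 * (y*z + 4/17*z^2 + x*y)^2
      + 3/34 * (z^2 - 17/18*x*y)^2
      + 13/216 * (x*y)^2"
    unfolding tensor_quartic_def by (simp add: field_simps) algebra
  moreover have "(x*y)^2 > 0" using assms by simp
  ultimately show ?thesis by (simp add: add_nonneg_pos)
qed

lemma tensor_quartic_upper_corner_pos:
  assumes "x * y * z \<noteq> 0"
  shows "tensor_quartic 1 (-1/4) (-1/6) (-1/6) x y z > 0"
proof -
  have "tensor_quartic 1 (-1/4) (-1/6) (-1/6) x y z =
      (x^2 - 1/2*z^2 - 1/2*y^2 - 2*x*y + 1/4*y*z + 2*x*z)^2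
      + 3/4 * (z^2 - 14/15*y^2 - 4/5*x*y + 17/6*y*z - 4/3*x*z)^2
      + 29/300 * (y^2 + 132/29*x*y + 65/58*y*z + 80/29*x*z)^2
      + 15/29 * (x*y + 49/50*y*z + 137/300*x*z)^2
      + 397/2000 * (y*z + 806/397*x*z)^2
      + 95/19056 * (x*z)^2"
    unfolding tensor_quartic_def by (simp add: field_simps) algebra
  moreover have "(x*z)^2 > 0" using assms by simp
  ultimately show ?thesis by (simp add: add_nonneg_pos)
qed

lemma tensor_quartic_pos_on_coordinate_plane:
  assumes "(x, y) \<noteq> (0, 0)"
  shows "tensor_quartic 1 a b c x y 0 > 0"
proof -
  have "tensor_quartic 1 a b c x y 0 = (x^2 - 2*x*y - y^2)^2 + (2*x*y)^2"
    unfolding tensor_quartic_def by simp algebra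
  moreover have "(x^2 - 2*x*y - y^2)^2 + (2*x*y)^2 > 0"
    using assms by (auto simp: sum_power2_gt_zero_iff)
  ultimately show ?thesis by simp
qed

section \<open>Comparison with the corners\<close>

lemma tensor_quartic_diff:
  "tensor_quartic e a b c x y z - tensor_quartic e a' b' c' x y z =
     12 * ((a - a') * (x * x * (y * z)) + (b - b') * (y * y * (z * x)) + (c - c') * (z * z * (x * y)))"
  unfolding tensor_quartic_def by algebra

lemma tensor_quartic_pos_if_products_pos:
  assumes "a > -7/12" "b > -7/12" "c > -7/12" and "y * z > 0" "z * x > 0" "x * y > 0"
  shows "tensor_quartic 1 a b c x y z > 0"
proof -
  have "(a + 7/12) * (x * x * (y * z)) > 0" "(b + 7/12) * (y * y * (z * x)) > 0"
    "(c + 7/12) * (z * z * (x * y)) > 0"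
    using assms by (auto intro!: mult_pos_pos simp: zero_less_mult_iff)
  then show ?thesis
    using tensor_quartic_diff[of 1 a b c x y z "-7/12" "-7/12" "-7/12"]
      tensor_quartic_lower_corner_nonneg[of x y z] by simp
qed

lemma tensor_quartic_pos_if_one_product_pos:
  assumes box: "(l, u) = (-7/12, -1/4) \<or> (l, u) = (-1/4, -1/6)"
    and "l \<le> a" "b \<le> u" "c \<le> u" and "y * z > 0" "z * x < 0" "x * y < 0"
  shows "tensor_quartic 1 a b c x y z > 0"
proof -
  have "x * x * (y * z) \<ge> 0" "y * y * (z * x) \<le> 0" "z * z * (x * y) \<le> 0"
    using assms by (simp_all only: mult_nonneg_nonneg mult_nonneg_nonpos zero_le_square less_imp_le)
  then have "(a - l) * (x * x * (y * z)) \<ge> 0" "(b - u) * (y * y * (z * x)) \<ge> 0"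
    "(c - u) * (z * z * (x * y)) \<ge> 0"
    using assms(2-4) by (simp_all only: mult_nonneg_nonneg mult_nonpos_nonpos diff_ge_0_iff_ge diff_le_0_iff_le)
  then have "tensor_quartic 1 a b c x y z \<ge> tensor_quartic 1 l u u x y z"
    using tensor_quartic_diff[of 1 a b c x y z l u u] by simp
  moreover have "x * y * z \<noteq> 0" using assms by auto
  then have "tensor_quartic 1 l u u x y z > 0"
    using box tensor_quartic_corner_pos tensor_quartic_upper_corner_pos by auto
  ultimately show ?thesis by simp
qed

lemma tensor_quartic_one_pos:
  assumes box: "(l, u) = (-7/12, -1/4) \<or> (l, u) = (-1/4, -1/6)"
    and range: "a \<in> {l..u}" "b \<in> {l..u}" "c \<in> {l..u}"
    and lower: "a > -7/12" "b > -7/12" "c > -7/12"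
    and nonzero: "(x, y, z) \<noteq> (0, 0, 0)"
  shows "tensor_quartic 1 a b c x y z > 0"
proof (cases "x * y * z = 0")
  case True
  then consider "x = 0" | "y = 0" | "z = 0" by auto
  then show ?thesis
  proof cases
    case 1
    then show ?thesis
      using nonzero tensor_quartic_pos_on_coordinate_plane[of y z b c a]
        tensor_quartic_cycle[of 1 a b c x y z] by simp
  next
    case 2
    then show ?thesis
      using nonzero tensor_quartic_pos_on_coordinate_plane[of z x c a b]
        tensor_quartic_cycle[of 1 c a b z x y] by auto
  next
    case 3
    then show ?thesis
      using nonzero tensor_quartic_pos_on_coordinate_plane by simp
  qed
next
  case False
  then consider "y * z > 0" "z * x > 0" "x * y > 0" | "y * z > 0" "z * x < 0" "x * y < 0"
    | "z * x > 0" "x * y < 0" "y * z < 0" | "x * y > 0" "y * z < 0" "z * x < 0"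
    by (auto simp: zero_less_mult_iff mult_less_0_iff linorder_neq_iff)
  then show ?thesis
  proof cases
    case 1
    with lower show ?thesis by (rule tensor_quartic_pos_if_products_pos)
  next
    case 2
    with box range show ?thesis by (intro tensor_quartic_pos_if_one_product_pos) auto
  next
    case 3
    then have "tensor_quartic 1 b c a y z x > 0"
      using range by (intro tensor_quartic_pos_if_one_product_pos[OF box]) auto
    then show ?thesis by (simp add: tensor_quartic_cycle[of 1 a b c x y z])
  next
    case 4
    then have "tensor_quartic 1 c a b z x y > 0"
      using range by (intro tensor_quartic_pos_if_one_product_pos[OF box]) auto
    then show ?thesis by (simp add: tensor_quartic_cycle[of 1 c a b z x y])
  qed
qed

lemma tensor_quartic_pos:
  assumes sign: "\<bar>e\<bar> = 1"
    and box: "(l, u) = (-7/12, -1/4) \<or> (l, u) = (-1/4, -1/6)"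
    and range: "a \<in> {l..u}" "b \<in> {l..u}" "c \<in> {l..u}"
    and lower: "a > -7/12" "b > -7/12" "c > -7/12"
    and nonzero: "(x, y, z) \<noteq> (0, 0, 0)"
  shows "tensor_quartic e a b c x y z > 0"
proof (cases "e = 1")
  case True
  then show ?thesis using tensor_quartic_one_pos[OF box range lower nonzero] by simp
next
  case False
  with sign have "e = - 1" by linarith
  moreover have "tensor_quartic 1 b a c y x z > 0"
    using nonzero range lower by (intro tensor_quartic_one_pos[OF box]) auto
  ultimately show ?thesis by (simp add: tensor_quartic_swap)
qed

theorem theorem4p6:
  fixes T :: "3 tensor4"
  assumes "symmetric_tensor4 T"
    and "T $ 1 $ 2 $ 2 $ 2 = T $ 2 $ 3 $ 3 $ 3" and "T $ 2 $ 3 $ 3 $ 3 = T $ 1 $ 1 $ 1 $ 3"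
    and "T $ 1 $ 1 $ 1 $ 2 = T $ 1 $ 3 $ 3 $ 3" and "T $ 1 $ 3 $ 3 $ 3 = T $ 2 $ 2 $ 2 $ 3"
    and "\<And>i j. i \<noteq> j \<Longrightarrow> \<bar>T $ i $ i $ i $ j\<bar> = 1"
    and "\<And>i j. i \<noteq> j \<Longrightarrow> T $ i $ i $ i $ i = 1"
    and "\<And>i j. i \<noteq> j \<Longrightarrow> T $ i $ i $ j $ j = 1"
    and "\<And>i j. i \<noteq> j \<Longrightarrow> T $ i $ j $ j $ j * T $ i $ i $ i $ j = -1"
  shows "(T $ 1 $ 1 $ 2 $ 3 \<in> {- 7 / 12 <.. - 1 / 4} \<and>
          T $ 1 $ 2 $ 2 $ 3 \<in> {- 7 / 12 <.. - 1 / 4} \<and>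
          T $ 1 $ 2 $ 3 $ 3 \<in> {- 7 / 12 <.. - 1 / 4} \<longrightarrow> positive_definite_tensor4 T) \<and>
         (T $ 1 $ 1 $ 2 $ 3 \<in> {- 1 / 4 .. - 1 / 6} \<and>
          T $ 1 $ 2 $ 2 $ 3 \<in> {- 1 / 4 .. - 1 / 6} \<and>
          T $ 1 $ 2 $ 3 $ 3 \<in> {- 1 / 4 .. - 1 / 6} \<longrightarrow> positive_definite_tensor4 T)"
proof -
  define e where "e = T $ 1 $ 2 $ 2 $ 2"
  have idx: "(1::3) \<noteq> 2" "(2::3) \<noteq> 3" "(1::3) \<noteq> 3" by simp_all
  have sign: "\<bar>e\<bar> = 1" and minus: "T $ 1 $ 1 $ 1 $ 2 = - e"
  proof -
    have "\<bar>T $ 1 $ 1 $ 1 $ 3\<bar> = 1" using assms(6) idx by blast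
    then show sign: "\<bar>e\<bar> = 1" using assms(2,3) by (simp add: e_def)
    have "e * T $ 1 $ 1 $ 1 $ 2 = - 1" using assms(9)[OF idx(1)] by (simp add: e_def)
    with sign show "T $ 1 $ 1 $ 1 $ 2 = - e" by (auto simp: abs_if split: if_splits)
  qed
  have form: "tensor4_form T x =
      tensor_quartic e (T $ 1 $ 1 $ 2 $ 3) (T $ 1 $ 2 $ 2 $ 3) (T $ 1 $ 2 $ 3 $ 3) (x $ 1) (x $ 2) (x $ 3)" for x
  proof (rule tensor4_form_eq_tensor_quartic[OF assms(1)])
    show "T $ 1 $ 1 $ 1 $ 1 = 1" "T $ 2 $ 2 $ 2 $ 2 = 1" "T $ 3 $ 3 $ 3 $ 3 = 1"
      using assms(7) idx by metis+
    show "T $ 1 $ 1 $ 2 $ 2 = 1" "T $ 2 $ 2 $ 3 $ 3 = 1" "T $ 1 $ 1 $ 3 $ 3 = 1"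
      using assms(8) idx by blast+
    show "T $ 1 $ 2 $ 2 $ 2 = e" "T $ 2 $ 3 $ 3 $ 3 = e" "T $ 1 $ 1 $ 1 $ 3 = e"
      using assms(2,3) by (simp_all add: e_def)
    show "T $ 1 $ 1 $ 1 $ 2 = - e" "T $ 1 $ 3 $ 3 $ 3 = - e" "T $ 2 $ 2 $ 2 $ 3 = - e"
      using minus assms(4,5) by simp_all
  qed
  have nonzero: "(x $ 1, x $ 2, x $ 3) \<noteq> (0, 0, 0)" if "x \<noteq> 0" for x :: "real ^ 3"
    using that by (auto simp: vec_eq_iff forall_3)
  have pos: "positive_definite_tensor4 T"
    if box: "(l, u) = (-7/12, -1/4) \<or> (l, u) = (-1/4, -1/6)"
      and "{T $ 1 $ 1 $ 2 $ 3, T $ 1 $ 2 $ 2 $ 3, T $ 1 $ 2 $ 3 $ 3} \<subseteq> {l..u} \<inter> {-7/12<..}" for l u :: real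
    unfolding positive_definite_tensor4_def form
    using that nonzero by (intro allI impI tensor_quartic_pos[OF sign box]) auto
  show ?thesis
  proof (intro conjI impI; elim conjE)
    assume "T $ 1 $ 1 $ 2 $ 3 \<in> {- 7 / 12 <.. - 1 / 4}" "T $ 1 $ 2 $ 2 $ 3 \<in> {- 7 / 12 <.. - 1 / 4}"
      "T $ 1 $ 2 $ 3 $ 3 \<in> {- 7 / 12 <.. - 1 / 4}"
    then show "positive_definite_tensor4 T" by (intro pos[of "-7/12" "-1/4"]) auto
  next
    assume "T $ 1 $ 1 $ 2 $ 3 \<in> {- 1 / 4 .. - 1 / 6}" "T $ 1 $ 2 $ 2 $ 3 \<in> {- 1 / 4 .. - 1 / 6}"
      "T $ 1 $ 2 $ 3 $ 3 \<in> {- 1 / 4 .. - 1 / 6}"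
    then show "positive_definite_tensor4 T" by (intro pos[of "-1/4" "-1/6"]) auto
  qed
qed

end
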